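(* Let $r,p$ be positive integers. For every ordered graph $(G,<)\in\mathrm{Bal}_p$ there is an ordered graph $(H,<)\in\mathrm{Bal}_p$ such that for every coloring of the edges of $H$ by $r$ colors there is a monochromatic subgraph $(G',<)$ of $(H,<)$ that is isomorphic (as an ordered graph) to $(G,<)$.
   Context: An ordered graph $(G,<)$ is a finite undirected (simple, loopless) graph $G$ with a fixed linear ordering $<$ of its vertices. Two ordered graphs are isomorphic if the unique order-preserving bijection between their vertex sets is a graph isomorphism. $(G,<)$ is a subgraph of $(H,<')$ if $G$ is a subgraph of $H$ (not necessarily induced) and the two orderings coincide on $V(G)$. A circuit $C=v_1,\dots,v_l$ in an ordered graph is balanced if $$|\{i: v_i<v_{(i\bmod l)+1}\}|=|\{i: v_i>v_{(i\bmod l)+1}\}|,$$ and unbalanced otherwise. $\mathrm{Bal}_p$ is the set of all ordered graphs that contain no unbalanced circuit of length at most $p$. A subgraph is monochromatic if all its edges have the same color. *)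

theory Defs
  imports Main
begin

record 'a ordered_graph =
  verts :: "'a set"
  edges :: "'a set set"
  less_rel :: "('a \<times> 'a) set"

text \<open>
  The relation \<open>less_rel\<close> is the strict ordering of the vertices. It is required to live on
  \<open>verts\<close>, so that comparing or restricting orderings is not affected by pairs outside.
\<close>

definition ordered_graph :: "'a ordered_graph \<Rightarrow> bool" where
  "ordered_graph G \<longleftrightarrow>
     finite (verts G) \<and>
     (\<forall>e \<in> edges G. e \<subseteq> verts G \<and> card e = 2) \<and>
     less_rel G \<subseteq> verts G \<times> verts G \<and>
     strict_linear_order_on (verts G) (less_rel G)"

definition isomorphic :: "'a ordered_graph \<Rightarrow> 'b ordered_graph \<Rightarrow> bool" where
  "isomorphic G H \<longleftrightarrow>
     (\<exists>f. bij_betw f (verts G) (verts H) \<and>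
          (\<forall>u \<in> verts G. \<forall>v \<in> verts G. (u, v) \<in> less_rel G \<longleftrightarrow> (f u, f v) \<in> less_rel H) \<and>
          (\<forall>u \<in> verts G. \<forall>v \<in> verts G. {u, v} \<in> edges G \<longleftrightarrow> {f u, f v} \<in> edges H))"

definition subgraph :: "'a ordered_graph \<Rightarrow> 'a ordered_graph \<Rightarrow> bool" where
  "subgraph G H \<longleftrightarrow>
     ordered_graph G \<and> ordered_graph H \<and>
     verts G \<subseteq> verts H \<and> edges G \<subseteq> edges H \<and>
     less_rel G = less_rel H \<inter> verts G \<times> verts G"

text \<open>
  A circuit is a graph cycle: at least three vertices, pairwise distinct. It is given by its
  list of vertices, with indices running from \<open>0\<close> to \<open>length c - 1\<close>, so that the cyclic successor
  of \<open>i\<close> is \<open>Suc i mod length c\<close>.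
\<close>

definition circuit :: "'a ordered_graph \<Rightarrow> 'a list \<Rightarrow> bool" where
  "circuit G c \<longleftrightarrow>
     3 \<le> length c \<and> distinct c \<and> set c \<subseteq> verts G \<and>
     (\<forall>i < length c. {c ! i, c ! (Suc i mod length c)} \<in> edges G)"

definition balanced :: "'a ordered_graph \<Rightarrow> 'a list \<Rightarrow> bool" where
  "balanced G c \<longleftrightarrow>
     card {i. i < length c \<and> (c ! i, c ! (Suc i mod length c)) \<in> less_rel G} =
     card {i. i < length c \<and> (c ! (Suc i mod length c), c ! i) \<in> less_rel G}"

definition Bal :: "nat \<Rightarrow> 'a ordered_graph set" where
  "Bal p = {G. ordered_graph G \<and> \<not> (\<exists>c. circuit G c \<and> length c \<le> p \<and> \<not> balanced G c)}"

definition edge_coloring :: "nat \<Rightarrow> 'a ordered_graph \<Rightarrow> ('a set \<Rightarrow> nat) \<Rightarrow> bool" where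
  "edge_coloring r G \<chi> \<longleftrightarrow> (\<forall>e \<in> edges G. \<chi> e < r)"

definition monochromatic :: "('a set \<Rightarrow> nat) \<Rightarrow> 'a ordered_graph \<Rightarrow> bool" where
  "monochromatic \<chi> G \<longleftrightarrow> (\<forall>e \<in> edges G. \<forall>e' \<in> edges G. \<chi> e = \<chi> e')"

end

theory Submission
  imports "HOL-Library.FuncSet" "HOL-Library.Ramsey" "HOL-Library.Countable" Defs
begin

text \<open>
  Orient every edge upwards. Then \<open>Bal p\<close> says that a closed walk of length at most \<open>p\<close> runs
  through as many arcs forwards as backwards, a condition that pulls back along homomorphisms.
  The theorem is proved by induction on \<open>p\<close>, starting from Ramsey's theorem for pairs.

  Given a Ramsey graph \<open>D\<close> that is balanced up to length \<open>p\<close>, the partite construction over \<open>D\<close>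
  yields a Ramsey graph that is balanced up to length \<open>p + 1\<close>. One starts with disjoint copies of
  \<open>G\<close>, one over each copy of \<open>G\<close> in \<open>D\<close>. For each arc \<open>(u, w)\<close> of \<open>D\<close> in turn one then glues
  copies of the current system along the bipartite graph between the fibres of \<open>u\<close> and \<open>w\<close>, as
  prescribed by the Hales-Jewett theorem for the alphabet of arcs between these fibres.

  Why the amalgam stays balanced: a closed walk of length at most \<open>p\<close> projects to a balanced one in
  \<open>D\<close>. A closed walk of length \<open>p + 1\<close> is cut at its visits to the fibres of \<open>u\<close> and \<open>w\<close>; both
  pieces project to closed walks of \<open>D\<close>, after adding the arc \<open>(u, w)\<close> if necessary, of length at
  most \<open>p\<close>, unless there is no such cut or one piece is a single arc. In these exceptional cases the
  walk lies in one copy, because every copy is induced between the two fibres.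
\<close>

section \<open>The Hales-Jewett theorem\<close>

text \<open>Combinatorial lines are encoded as templates with the wildcard \<open>None\<close>;
  \<open>inst\<close> produces their points.\<close>

definition inst :: "'a option list \<Rightarrow> 'a \<Rightarrow> 'a list" where
  "inst w a = map (\<lambda>c. case c of None \<Rightarrow> a | Some b \<Rightarrow> b) w"

definition line :: "'a set \<Rightarrow> nat \<Rightarrow> 'a option list \<Rightarrow> bool" where
  "line A n w \<longleftrightarrow> length w = n \<and> None \<in> set w \<and> set w \<subseteq> insert None (Some ` A)"

definition words :: "'a set \<Rightarrow> nat \<Rightarrow> 'a list set" where
  "words A n = {v. set v \<subseteq> A \<and> length v = n}"

definition mono_line :: "('a list \<Rightarrow> 'b) \<Rightarrow> 'a set \<Rightarrow> 'a option list \<Rightarrow> bool" where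
  "mono_line \<chi> A w \<longleftrightarrow> (\<forall>a\<in>A. \<forall>b\<in>A. \<chi> (inst w a) = \<chi> (inst w b))"

lemma inst_append [simp]: "inst (w @ w') a = inst w a @ inst w' a"
  and inst_map_Some [simp]: "inst (map Some v) a = v"
  and length_inst [simp]: "length (inst w a) = length w"
  by (simp_all add: inst_def comp_def)

lemma inst_in_words:
  assumes "line A n w" "a \<in> A" shows "inst w a \<in> words A n"
  using assms by (fastforce simp: words_def line_def inst_def split: option.splits)

lemma line_mono: "line A n w \<Longrightarrow> A \<subseteq> B \<Longrightarrow> line B n w"
  unfolding line_def by blast

lemma line_append: "line A m w \<Longrightarrow> line A n w' \<Longrightarrow> line A (m + n) (w @ w')"
  by (auto simp: line_def)

lemma line_append_word: "line A m w \<Longrightarrow> v \<in> words A n \<Longrightarrow> line A (m + n) (w @ map Some v)"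
  by (auto simp: line_def words_def)

lemma line_word_append: "v \<in> words A m \<Longrightarrow> line A n w \<Longrightarrow> line A (m + n) (map Some v @ w)"
  by (auto simp: line_def words_def)

lemma mono_line_word_append:
  "mono_line \<chi> A (map Some v @ w) \<longleftrightarrow> mono_line (\<lambda>u. \<chi> (v @ u)) A w"
  by (simp add: mono_line_def)

lemma finite_words: "finite A \<Longrightarrow> finite (words A n)"
  unfolding words_def by (rule finite_lists_length_eq)

definition HJ :: "'a set \<Rightarrow> nat \<Rightarrow> nat \<Rightarrow> bool" where
  "HJ A r n \<longleftrightarrow> (\<forall>\<chi>. (\<forall>v. \<chi> v < r) \<longrightarrow> (\<exists>w. line A n w \<and> mono_line \<chi> A w))"

text \<open>Renumbering of the palette, since colour focusing uses whole colourings of suffixes as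
  colours.\<close>

lemma HJ_finite_colours:
  fixes A :: "'a set" and C :: "'b set"
  assumes HJ: "\<And>r. \<exists>n. HJ A r n" and C: "finite C"
  shows "\<exists>n. \<forall>\<chi>. (\<forall>v. \<chi> v \<in> C) \<longrightarrow> (\<exists>w. line A n w \<and> mono_line \<chi> A w)"
proof -
  obtain h :: "_ \<Rightarrow> nat" and r where h: "h ` C = {i. i < r}" "inj_on h C"
    using finite_imp_inj_to_nat_seg[OF C] by auto
  obtain n where n: "HJ A r n" using HJ by blast
  show ?thesis
  proof (intro exI[of _ n] allI impI)
    fix \<chi> :: "'a list \<Rightarrow> 'b" assume \<chi>: "\<forall>v. \<chi> v \<in> C"
    then have "\<forall>v. (h \<circ> \<chi>) v < r" using h by auto
    then obtain w where "line A n w" "mono_line (h \<circ> \<chi>) A w"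
      using n unfolding HJ_def by blast
    moreover from this(2) have "mono_line \<chi> A w"
      using h(2) \<chi> unfolding mono_line_def by (auto dest: inj_onD)
    ultimately show "\<exists>w. line A n w \<and> mono_line \<chi> A w" by blast
  qed
qed

text \<open>
  Colour focusing: unless there is a monochromatic line, any number of lines can be found that
  pass through one word at the letter \<open>a\<close> and are monochromatic in pairwise distinct colours on
  the other letters.
\<close>

lemma focused_lines:
  fixes A :: "'a set" and r k :: nat
  assumes A: "finite A" and b: "b \<in> A" and HJ: "\<And>r. \<exists>n. HJ A r n"
  shows "\<exists>n. \<forall>\<chi>. (\<forall>v. \<chi> v < r) \<longrightarrow>
           (\<exists>w. line (insert a A) n w \<and> mono_line \<chi> (insert a A) w) \<or>
           (\<exists>ws f. length ws = k \<and> f \<in> words (insert a A) n \<and>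
              (\<forall>w \<in> set ws. line (insert a A) n w \<and> inst w a = f \<and> mono_line \<chi> A w) \<and>
              distinct (map (\<lambda>w. \<chi> (inst w b)) ws))"
proof (induction k)
  case 0
  show ?case
    by (rule exI[of _ 0]) (auto simp: words_def)
next
  case (Suc k)
  let ?A = "insert a A"
  obtain n where n: "\<And>\<chi>. (\<forall>v. \<chi> v < r) \<Longrightarrow>
           (\<exists>w. line ?A n w \<and> mono_line \<chi> ?A w) \<or>
           (\<exists>ws f. length ws = k \<and> f \<in> words ?A n \<and>
              (\<forall>w \<in> set ws. line ?A n w \<and> inst w a = f \<and> mono_line \<chi> A w) \<and>
              distinct (map (\<lambda>w. \<chi> (inst w b)) ws))"
    using Suc by blast
  \<comment> \<open>A prefix is coloured by the colouring that it induces on the suffixes of length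
    \<open>n\<close>. Restricting the latter to \<open>words ?A n\<close> keeps this palette
    finite.\<close>
  let ?C = "words ?A n \<rightarrow>\<^sub>E {..<r}"
  have "finite ?C" using A by (intro finite_PiE finite_words) auto
  from HJ_finite_colours[OF HJ this] obtain m where
    m: "\<And>\<chi>. (\<forall>v. \<chi> v \<in> ?C) \<Longrightarrow> \<exists>w. line A m w \<and> mono_line \<chi> A w"
    by blast
  show ?case
  proof (intro exI[of _ "m + n"] allI impI)
    fix \<chi> :: "'a list \<Rightarrow> nat" assume \<chi>: "\<forall>v. \<chi> v < r"
    have "\<forall>u. (\<lambda>v\<in>words ?A n. \<chi> (u @ v)) \<in> ?C" using \<chi> by auto
    from m[OF this] obtain W where W: "line A m W"
      and mW: "mono_line (\<lambda>u. \<lambda>v\<in>words ?A n. \<chi> (u @ v)) A W" by blast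
    have W': "line ?A m W" using W by (rule line_mono) auto
    have Wb: "inst W b \<in> words ?A m" using W' b by (auto intro: inst_in_words)
    have eq: "\<chi> (inst W c @ v) = \<chi> (inst W b @ v)" if "c \<in> A" "v \<in> words ?A n" for c v
    proof -
      have "(\<lambda>v\<in>words ?A n. \<chi> (inst W c @ v)) = (\<lambda>v\<in>words ?A n. \<chi> (inst W b @ v))"
        using mW that b unfolding mono_line_def by blast
      from fun_cong[OF this, of v] show ?thesis using that by simp
    qed
    \<comment> \<open>All letters of \<open>A\<close>, put into \<open>W\<close>, induce the same
      colouring of the suffixes, so \<open>b\<close> can represent them.\<close>
    let ?\<chi> = "\<lambda>v. \<chi> (inst W b @ v)"
    have "\<forall>v. ?\<chi> v < r" using \<chi> by simp
    from n[of ?\<chi>, OF this]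
    consider (mono) w where "line ?A n w" "mono_line ?\<chi> ?A w"
      | (focused) ws f where "length ws = k" "f \<in> words ?A n"
          "\<forall>w\<in>set ws. line ?A n w \<and> inst w a = f \<and> mono_line ?\<chi> A w"
          "distinct (map (\<lambda>w. ?\<chi> (inst w b)) ws)"
      by blast
    then show "(\<exists>w. line ?A (m + n) w \<and> mono_line \<chi> ?A w) \<or>
           (\<exists>ws f. length ws = Suc k \<and> f \<in> words ?A (m + n) \<and>
              (\<forall>w \<in> set ws. line ?A (m + n) w \<and> inst w a = f \<and> mono_line \<chi> A w) \<and>
              distinct (map (\<lambda>w. \<chi> (inst w b)) ws))"
    proof cases
      case w: mono
      show ?thesis
        using line_word_append[OF Wb w(1)] w(2) mono_line_word_append by blast
    next
      case focused
      note len = focused(1) and f = focused(2) and ws = focused(3) and dist = focused(4)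
      show ?thesis
      proof (cases "\<exists>w\<in>set ws. ?\<chi> (inst w b) = ?\<chi> f")
        \<comment> \<open>A focused line that has the colour of its focus \<open>f\<close> is
          monochromatic at the letter \<open>a\<close> too.\<close>
        case True
        then obtain w where w: "w \<in> set ws" "?\<chi> (inst w b) = ?\<chi> f" by blast
        have "\<forall>c\<in>?A. ?\<chi> (inst w c) = ?\<chi> f"
          using w ws b unfolding mono_line_def by (metis insertE)
        then have "mono_line ?\<chi> ?A w" by (simp add: mono_line_def)
        then show ?thesis using line_word_append[OF Wb] w ws mono_line_word_append by blast
      next
        case False
        \<comment> \<open>The first line varies only in the prefix and has, on \<open>A\<close>, the
          colour of the old focus, which no old line has. The old lines now vary in prefix and
          suffix together and keep their colours. At \<open>a\<close> all of them meet in
          \<open>inst W a @ f\<close>.\<close>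
        let ?ws = "(W @ map Some f) # map (\<lambda>w. W @ w) ws"
        have eqw: "\<chi> (inst W c @ inst w c) = ?\<chi> (inst w b)" if "c \<in> A" "w \<in> set ws" for c w
        proof -
          have "inst w c \<in> words ?A n" using that ws by (auto intro: inst_in_words)
          then have "\<chi> (inst W c @ inst w c) = ?\<chi> (inst w c)" using eq that by blast
          also have "\<dots> = ?\<chi> (inst w b)" using ws that b unfolding mono_line_def by blast
          finally show ?thesis .
        qed
        have "mono_line \<chi> A (W @ map Some f)" using eq f by (simp add: mono_line_def)
        moreover have "mono_line \<chi> A (W @ w)" if "w \<in> set ws" for w
          using eqw that by (simp add: mono_line_def)
        moreover have "inst W a \<in> words ?A m" using W' by (auto intro: inst_in_words)
        then have "inst W a @ f \<in> words ?A (m + n)" using f by (auto simp: words_def)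
        moreover have "distinct (map (\<lambda>w. \<chi> (inst w b)) ?ws)"
          using False dist by (auto simp: comp_def)
        moreover have "\<forall>w\<in>set ?ws. line ?A (m + n) w \<and> inst w a = inst W a @ f"
          using ws line_append[OF W'] line_append_word[OF W' f] by auto
        moreover have "length ?ws = Suc k" using len by simp
        ultimately show ?thesis
          by (intro disjI2 exI[of _ ?ws] exI[of _ "inst W a @ f"]) simp
      qed
    qed
  qed
qed

text \<open>Induction on the alphabet. Among \<open>r\<close> colours there cannot be
  \<open>r + 1\<close> focused lines of distinct colours, so focusing must end with a monochromatic
  line.\<close>

lemma hales_jewett:
  assumes "finite A" shows "\<exists>n. HJ A r n"
  using assms
proof (induction A arbitrary: r rule: finite_induct)
  case empty
  have "HJ {} r 1"
    unfolding HJ_def by (auto simp: line_def mono_line_def intro!: exI[of _ "[None]"])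
  then show ?case by blast
next
  case (insert a A)
  show ?case
  proof (cases "A = {}")
    \<comment> \<open>Focusing needs a letter \<open>b\<close> of \<open>A\<close>. Over the single
      letter \<open>a\<close> the line \<open>[None]\<close> has only one point.\<close>
    case True
    have "HJ {a} r 1"
      unfolding HJ_def by (auto simp: line_def mono_line_def intro!: exI[of _ "[None]"])
    then show ?thesis using True by blast
  next
    case False
    then obtain b where b: "b \<in> A" by blast
    obtain n where n: "\<And>\<chi>. (\<forall>v. \<chi> v < r) \<Longrightarrow>
           (\<exists>w. line (insert a A) n w \<and> mono_line \<chi> (insert a A) w) \<or>
           (\<exists>ws f. length ws = Suc r \<and> f \<in> words (insert a A) n \<and>
              (\<forall>w \<in> set ws. line (insert a A) n w \<and> inst w a = f \<and> mono_line \<chi> A w) \<and>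
              distinct (map (\<lambda>w. \<chi> (inst w b)) ws))"
      using focused_lines[OF insert.hyps(1) b insert.IH, of r a "Suc r"] by blast
    have "HJ (insert a A) r n"
      unfolding HJ_def
    proof (intro allI impI)
      fix \<chi> :: "'a list \<Rightarrow> nat" assume \<chi>: "\<forall>v. \<chi> v < r"
      have False if "length ws = Suc r" "distinct (map (\<lambda>w. \<chi> (inst w b)) ws)" for ws
      proof -
        have "set (map (\<lambda>w. \<chi> (inst w b)) ws) \<subseteq> {..<r}" using \<chi> by auto
        then have "card (set (map (\<lambda>w. \<chi> (inst w b)) ws)) \<le> r"
          by (metis card_lessThan card_mono finite_lessThan)
        then show False using distinct_card[OF that(2)] that(1) by simp
      qed
      then show "\<exists>w. line (insert a A) n w \<and> mono_line \<chi> (insert a A) w"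
        using n[OF \<chi>] by blast
    qed
    then show ?thesis by blast
  qed
qed

section \<open>Balanced digraphs and their amalgams\<close>

definition step :: "('a \<times> 'a) set \<Rightarrow> int \<Rightarrow> 'a \<Rightarrow> 'a \<Rightarrow> bool" where
  "step A s x y \<longleftrightarrow> s = 1 \<and> (x, y) \<in> A \<or> s = -1 \<and> (y, x) \<in> A"

text \<open>
  \<open>walk A x n b y\<close>: a walk of length \<open>n\<close> that disregards the directions of the arcs; \<open>b\<close> is the
  number of arcs traversed forwards minus the number of arcs traversed backwards.
\<close>

inductive walk :: "('a \<times> 'a) set \<Rightarrow> 'a \<Rightarrow> nat \<Rightarrow> int \<Rightarrow> 'a \<Rightarrow> bool" for A where
  Nil: "walk A x 0 0 x"
| Cons: "step A s x y \<Longrightarrow> walk A y n b z \<Longrightarrow> walk A x (Suc n) (s + b) z"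

text \<open>Closed walks replace circuits because a homomorphism maps a circuit only to a closed
  walk; this is what makes the condition pull back in \<open>bal_hom\<close>.\<close>

definition bal :: "nat \<Rightarrow> ('a \<times> 'a) set \<Rightarrow> bool" where
  "bal p A \<longleftrightarrow> (\<forall>x n b. walk A x n b x \<longrightarrow> n \<le> p \<longrightarrow> b = 0)"

lemma balD: "bal p A \<Longrightarrow> walk A x n b x \<Longrightarrow> n \<le> p \<Longrightarrow> b = 0"
  by (auto simp: bal_def)

lemma bal_mono: "bal p A \<Longrightarrow> q \<le> p \<Longrightarrow> bal q A"
  by (auto simp: bal_def)

lemma bal_0: "bal 0 A"
  unfolding bal_def by (auto elim: walk.cases)

lemma step_sym: "step A s x y \<Longrightarrow> step A (- s) y x"
  by (auto simp: step_def)

lemma step_hom: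
  assumes "\<And>x y. (x, y) \<in> A \<Longrightarrow> (f x, f y) \<in> B" "step A s x y"
  shows "step B s (f x) (f y)"
  using assms by (auto simp: step_def)

lemma walk_hom:
  assumes "\<And>x y. (x, y) \<in> A \<Longrightarrow> (f x, f y) \<in> B" "walk A x n b y"
  shows "walk B (f x) n b (f y)"
  using assms(2) by induction (auto intro: walk.intros step_hom[where f = f] assms(1))

lemma bal_hom:
  assumes "\<And>x y. (x, y) \<in> A \<Longrightarrow> (f x, f y) \<in> B" "bal p B"
  shows "bal p A"
  unfolding bal_def using balD[OF assms(2)] walk_hom[where f = f, OF assms(1)] by blast

lemma walk_append:
  assumes "walk A x m b y" "walk A y n c z" shows "walk A x (m + n) (b + c) z"
  using assms by induction (auto simp: add.assoc intro: walk.intros)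

lemma walk_single: "step A s x y \<Longrightarrow> walk A x 1 s y"
  using walk.Cons[OF _ walk.Nil] by fastforce

lemma walk_1D: "walk A x 1 b y \<Longrightarrow> step A b x y"
  by (auto elim!: walk.cases)

text \<open>The properties of the glued copies on which the balance argument rests, separated from
  the words that realise them.\<close>

locale amalgam =
  fixes A :: "('v \<times> 'v) set" and D :: "('h \<times> 'h) set" and \<pi> :: "'v \<Rightarrow> 'h"
    and I :: "'l set" and \<phi> :: "'l \<Rightarrow> 'v \<Rightarrow> 'z" and \<pi>' :: "'z \<Rightarrow> 'h" and u w :: 'h
  assumes hom: "(x, y) \<in> A \<Longrightarrow> (\<pi> x, \<pi> y) \<in> D"
    and uw: "(u, w) \<in> D" "(w, u) \<notin> D"
    and proj: "L \<in> I \<Longrightarrow> \<pi>' (\<phi> L x) = \<pi> x"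
    and inj: "L \<in> I \<Longrightarrow> \<phi> L x = \<phi> L y \<Longrightarrow> x = y"
    and free: "L \<in> I \<Longrightarrow> L' \<in> I \<Longrightarrow> \<phi> L x = \<phi> L' y \<Longrightarrow> \<pi> x \<noteq> u \<Longrightarrow> \<pi> x \<noteq> w \<Longrightarrow> L = L'"
    and induced: "L \<in> I \<Longrightarrow> L' \<in> I \<Longrightarrow> \<phi> L x = \<phi> L' a \<Longrightarrow> \<phi> L y = \<phi> L' b \<Longrightarrow>
      \<pi> x = u \<Longrightarrow> \<pi> y = w \<Longrightarrow> (a, b) \<in> A \<Longrightarrow> (x, y) \<in> A"
begin

definition arcs where "arcs = {(\<phi> L x, \<phi> L y) |L x y. L \<in> I \<and> (x, y) \<in> A}"

lemma arcs_hom: "(x, y) \<in> arcs \<Longrightarrow> (\<pi>' x, \<pi>' y) \<in> D"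
  by (auto simp: arcs_def proj hom)

lemma walk_proj: "walk arcs x n b y \<Longrightarrow> walk D (\<pi>' x) n b (\<pi>' y)"
  by (rule walk_hom[OF arcs_hom])

lemma stepE:
  assumes "step arcs s x y"
  obtains L a b where "L \<in> I" "x = \<phi> L a" "y = \<phi> L b" "step A s a b"
  using assms by (auto simp: step_def arcs_def)

text \<open>As \<open>D\<close> lacks the arc \<open>(w, u)\<close>, every arc between the two
  fibres points from that of \<open>u\<close> to that of \<open>w\<close>, where
  \<open>induced\<close> applies. A backward step swaps the ends.\<close>

lemma step_induced:
  assumes "step arcs s (\<phi> L a) (\<phi> L b)" "L \<in> I" "\<pi> a \<in> {u, w}" "\<pi> b \<in> {u, w}" "\<pi> a \<noteq> \<pi> b"
  shows "step A s a b"
proof -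
  have *: "(a, b) \<in> A" if ab: "(\<phi> L a, \<phi> L b) \<in> arcs" "\<pi> a \<in> {u, w}" "\<pi> b \<in> {u, w}" "\<pi> a \<noteq> \<pi> b" for a b
  proof -
    have "(\<pi> a, \<pi> b) \<in> D" using arcs_hom[OF that(1)] assms(2) by (simp add: proj)
    then have "\<pi> a = u" "\<pi> b = w" using that uw by auto
    moreover obtain L' a' b' where "L' \<in> I" "(a', b') \<in> A" "\<phi> L a = \<phi> L' a'" "\<phi> L b = \<phi> L' b'"
      using ab(1) unfolding arcs_def by blast
    ultimately show ?thesis using induced assms(2) by blast
  qed
  show ?thesis using assms *[of a b] *[of b a] by (auto simp: step_def)
qed

text \<open>A walk can change copies only at a vertex shared by two copies, and such a vertex lies
  over \<open>u\<close> or \<open>w\<close>. Hence a walk without inner vertices over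
  \<open>u\<close> and \<open>w\<close> stays in one copy.\<close>

lemma walk_copy_or_split:
  assumes "walk arcs x n b y" "0 < n"
  shows "(\<exists>L\<in>I. \<exists>x' y'. x = \<phi> L x' \<and> y = \<phi> L y' \<and> walk A x' n b y') \<or>
    (\<exists>z m m' c c'. \<pi>' z \<in> {u, w} \<and> 0 < m \<and> 0 < m' \<and> n = m + m' \<and> b = c + c' \<and>
       walk arcs x m c z \<and> walk arcs z m' c' y)"
  using assms
proof induction
  case (Nil x)
  then show ?case by simp
next
  case (Cons s x y n b z)
  obtain L x' y' where L: "L \<in> I" "x = \<phi> L x'" "y = \<phi> L y'" "step A s x' y'"
    using Cons.hyps(1) by (rule stepE)
  show ?case
  proof (cases "n = 0")
    case True
    then have "b = 0" "z = y" using Cons.hyps(2) by (auto elim: walk.cases)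
    then show ?thesis using True L walk_single[OF L(4)] by auto
  next
    case n: False
    show ?thesis
    proof (cases "\<pi>' y \<in> {u, w}")
      case True
      then show ?thesis
        using n Cons.hyps(2) walk_single[OF Cons.hyps(1)]
        by (intro disjI2 exI[of _ y] exI[of _ 1] exI[of _ n] exI[of _ s] exI[of _ b]) auto
    next
      case y: False
      from Cons.IH n consider
        (copy) L' a c where "L' \<in> I" "y = \<phi> L' a" "z = \<phi> L' c" "walk A a n b c"
        | (split) v m m' c c' where "\<pi>' v \<in> {u, w}" "0 < m" "0 < m'" "n = m + m'" "b = c + c'"
          "walk arcs y m c v" "walk arcs v m' c' z"
        by blast
      then show ?thesis
      proof cases
        case copy
        \<comment> \<open>Outside the two fibres a vertex determines its copy and its preimage, so
          the first step and the rest of the walk fit together.\<close>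
        have "\<pi> y' \<noteq> u" "\<pi> y' \<noteq> w" using y L proj by auto
        then have "L' = L" using free L copy by metis
        then have "a = y'" using inj L copy by metis
        then have "walk A x' (Suc n) (s + b) c" using walk.Cons[OF L(4)] copy(4) by simp
        then show ?thesis using L(1,2) copy(3) \<open>L' = L\<close> by (intro disjI1) blast
      next
        case split
        have "walk arcs x (Suc m) (s + c) v" using Cons.hyps(1) split(6) by (rule walk.Cons)
        then show ?thesis using split
          by (intro disjI2 exI[of _ v] exI[of _ "Suc m"] exI[of _ m'] exI[of _ "s + c"]
              exI[of _ c']) auto
      qed
    qed
  qed
qed

section \<open>Balance of the amalgam for closed walks of length up to \<open>p + 1\<close>\<close>

context
  fixes p assumes D: "bal p D" and A: "bal (Suc p) A"
begin

lemma closed_copy: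
  assumes "L \<in> I" "x = \<phi> L x'" "x = \<phi> L y'" "walk A x' n b y'" "n \<le> Suc p"
  shows "b = 0"
proof -
  have "x' = y'" using inj assms by metis
  then show ?thesis using assms balD[OF A] by blast
qed

text \<open>Only the projection has to be closed, not the walk itself.\<close>

lemma same_fibre:
  assumes "walk arcs x m b y" "\<pi>' x = \<pi>' y" "m \<le> p" shows "b = 0"
  using walk_proj[OF assms(1)] assms balD[OF D] by metis

text \<open>With the arc, the remaining walk projects to length \<open>p + 1\<close>, which is too
  long for \<open>D\<close>. If it stays in one copy, that copy contains the arc as well and
  \<open>A\<close> is balanced. Otherwise a further vertex over \<open>u\<close> or \<open>w\<close>
  cuts it, and the arc is joined to the piece whose projection it closes.\<close>

lemma adjacent_fibres:
  assumes "step arcs s z z'" "walk arcs z' p b z"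
    and z: "\<pi>' z \<in> {u, w}" "\<pi>' z' \<in> {u, w}" "\<pi>' z \<noteq> \<pi>' z'" and "0 < p"
  shows "s + b = 0"
  using walk_copy_or_split[OF assms(2) \<open>0 < p\<close>]
proof (elim disjE bexE exE conjE)
  fix L a c assume L: "L \<in> I" "z' = \<phi> L a" "z = \<phi> L c" and wk: "walk A a p b c"
  have "step A s c a" using assms(1) z L by (intro step_induced) (auto simp: proj)
  then have "walk A c (Suc p) (s + b) c" using wk by (rule walk.Cons)
  then show ?thesis using balD[OF A] by blast
next
  fix v m m' c c'
  assume v: "\<pi>' v \<in> {u, w}" "0 < m" "0 < m'" "p = m + m'" "b = c + c'"
    "walk arcs z' m c v" "walk arcs v m' c' z"
  show ?thesis
  proof (cases "\<pi>' v = \<pi>' z")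
    case True
    have "walk arcs z (Suc m) (s + c) v" using assms(1) v(6) by (rule walk.Cons)
    then have "s + c = 0" by (rule same_fibre) (use True v in auto)
    moreover have "c' = 0" using v(7) by (rule same_fibre) (use True v in auto)
    ultimately show ?thesis using v by simp
  next
    case False
    then have *: "\<pi>' v = \<pi>' z'" using v z by auto
    have "walk arcs v (m' + 1) (c' + s) z'" using v(7) walk_single[OF assms(1)] by (rule walk_append)
    then have "c' + s = 0" by (rule same_fibre) (use * v in auto)
    moreover have "c = 0" using v(6) by (rule same_fibre) (use * v in auto)
    ultimately show ?thesis using v by simp
  qed
qed

lemma closed_walk_balanced:
  assumes wk: "walk arcs x (Suc p) b x"
  shows "b = 0"
  using walk_copy_or_split[OF wk zero_less_Suc]
proof (elim disjE bexE exE conjE)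
  fix L x' y' assume "L \<in> I" "x = \<phi> L x'" "x = \<phi> L y'" "walk A x' (Suc p) b y'"
  then show ?thesis by (rule closed_copy) simp
next
  fix z m m' c c'
  assume z: "\<pi>' z \<in> {u, w}" "0 < m" "0 < m'" "Suc p = m + m'" "b = c + c'"
    "walk arcs x m c z" "walk arcs z m' c' x"
  \<comment> \<open>The walk is rotated to start over \<open>u\<close> or \<open>w\<close>, so that
    a second cut yields pieces with both ends over these fibres.\<close>
  have "walk arcs z (m' + m) (c' + c) z" using z(7,6) by (rule walk_append)
  then have wk': "walk arcs z (Suc p) b z" using z by (simp add: add.commute)
  show ?thesis using walk_copy_or_split[OF wk' zero_less_Suc]
  proof (elim disjE bexE exE conjE)
    fix L x' y' assume "L \<in> I" "z = \<phi> L x'" "z = \<phi> L y'" "walk A x' (Suc p) b y'"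
    then show ?thesis by (rule closed_copy) simp
  next
    fix v n n' d d'
    assume v: "\<pi>' v \<in> {u, w}" "0 < n" "0 < n'" "Suc p = n + n'" "b = d + d'"
      "walk arcs z n d v" "walk arcs v n' d' z"
    show ?thesis
    proof (cases "\<pi>' v = \<pi>' z")
      case True
      have "d = 0" "d' = 0" using True v same_fibre[OF v(6)] same_fibre[OF v(7)] by auto
      then show ?thesis using v by simp
    next
      case False
      have "0 < p" using v by simp
      \<comment> \<open>A piece of one step leaves a rest of length \<open>p\<close>. If both pieces
        have at least two steps, each has length below \<open>p\<close>, and closing it by an arc of
        \<open>D\<close> gives length at most \<open>p\<close>.\<close>
      consider "n = 1" | "n' = 1" | "n < p" "n' < p" using v by linarith
      then show ?thesis
      proof cases
        case 1
        then have "step arcs d z v" "walk arcs v p d' z" using v walk_1D by auto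
        then show ?thesis using adjacent_fibres[of d z v d'] z v False \<open>0 < p\<close> by simp
      next
        case 2
        then have "step arcs d' v z" "walk arcs z p d v" using v walk_1D by auto
        then show ?thesis using adjacent_fibres[of d' v z d] z v False \<open>0 < p\<close> by simp
      next
        case 3
        obtain s where s: "step D s (\<pi>' z) (\<pi>' v)"
          using z(1) v(1) False uw by (auto simp: step_def)
        \<comment> \<open>The same arc of \<open>D\<close> closes the two pieces in opposite
          directions, so its contributions cancel in the sum.\<close>
        have "walk D (\<pi>' z) (Suc n') (s + d') (\<pi>' z)"
          using walk.Cons[OF s walk_proj[OF v(7)]] .
        then have "s + d' = 0" using 3 balD[OF D] by fastforce
        moreover have "walk D (\<pi>' v) (Suc n) (- s + d) (\<pi>' v)"
          using walk.Cons[OF step_sym[OF s] walk_proj[OF v(6)]] .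
        then have "- s + d = 0" using 3 balD[OF D] by fastforce
        ultimately show ?thesis using v by simp
      qed
    qed
  qed
qed

lemma bal_arcs: "bal (Suc p) arcs"
  unfolding bal_def
proof (intro allI impI)
  fix x n b assume "walk arcs x n b x" "n \<le> Suc p"
  then show "b = 0"
    using closed_walk_balanced same_fibre[of x n b x] by (cases "n = Suc p") auto
qed

end
end

section \<open>The partite construction\<close>

text \<open>
  The vertices of the amalgam over the fibres \<open>u\<close> and \<open>w\<close> are words, namely the tails and the
  heads of words of arcs; a combinatorial line \<open>L\<close> in the alphabet of arcs yields the copy
  \<open>place u w \<pi> L\<close>.
\<close>

definition coord :: "('e \<Rightarrow> 'a) \<Rightarrow> 'e option list \<Rightarrow> 'a \<Rightarrow> 'a list" where
  "coord sel L x = map (case_option x sel) L"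

definition place :: "nat \<Rightarrow> nat \<Rightarrow> (nat \<Rightarrow> nat) \<Rightarrow> (nat \<times> nat) option list \<Rightarrow> nat \<Rightarrow>
    nat \<times> (nat list + (nat \<times> nat) option list \<times> nat)" where
  "place u w \<pi> L x = (\<pi> x, if \<pi> x = u then Inl (coord fst L x)
     else if \<pi> x = w then Inl (coord snd L x) else Inr (L, x))"

lemma coord_inj: "None \<in> set L \<Longrightarrow> coord sel L x = coord sel L y \<Longrightarrow> x = y"
  by (force simp: coord_def)

lemma coord_inst:
  "map fst (inst L (x, y)) = coord fst L x" "map snd (inst L (x, y)) = coord snd L y"
  by (auto simp: coord_def inst_def split: option.splits)

text \<open>At a wildcard of \<open>L\<close> the words show \<open>x\<close> and \<open>y\<close>
  themselves. At the same position \<open>L'\<close> has either a wildcard, showing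
  \<open>(a, b)\<close>, or a fixed letter of \<open>B\<close>; both are arcs in \<open>B\<close>.
  This yields \<open>induced\<close> for the concrete copies.\<close>

lemma coord_arc:
  assumes "None \<in> set L" "set L' \<subseteq> insert None (Some ` B)" "(a, b) \<in> B"
    and eq: "coord fst L x = coord fst L' a" "coord snd L y = coord snd L' b"
  shows "(x, y) \<in> B"
proof -
  obtain i where i: "i < length L" "L ! i = None"
    using assms(1) by (auto simp: in_set_conv_nth)
  have len: "length L' = length L" using arg_cong[OF eq(1), of length] by (simp add: coord_def)
  have "x = case_option a fst (L' ! i)" "y = case_option b snd (L' ! i)"
    using arg_cong[OF eq(1), of "\<lambda>v. v ! i"] arg_cong[OF eq(2), of "\<lambda>v. v ! i"] i len
    by (auto simp: coord_def)
  moreover have "L' ! i \<in> insert None (Some ` B)" using assms(2) i len nth_mem by (metis subsetD)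
  ultimately show ?thesis using assms(3) by auto
qed

section \<open>Partite systems over a digraph and their lifting property\<close>

definition partite :: "('h \<times> 'h) set \<Rightarrow> 'v set \<Rightarrow> ('v \<times> 'v) set \<Rightarrow> ('v \<Rightarrow> 'h) \<Rightarrow> bool" where
  "partite D V A \<pi> \<longleftrightarrow> finite V \<and> A \<subseteq> V \<times> V \<and> (\<forall>x y. (x, y) \<in> A \<longrightarrow> (\<pi> x, \<pi> y) \<in> D)"

text \<open>The partite arrow relation: over \<open>F\<close>, the colour of an arc in the copy
  becomes a function of its projection. The copy is a homomorphism over the base; the projection
  later supplies the order.\<close>

definition lifts :: "nat \<Rightarrow> ('h \<times> 'h) set \<Rightarrow> 'v set \<Rightarrow> ('v \<times> 'v) set \<Rightarrow> ('v \<Rightarrow> 'h) \<Rightarrow>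
    'w set \<Rightarrow> ('w \<times> 'w) set \<Rightarrow> ('w \<Rightarrow> 'h) \<Rightarrow> bool" where
  "lifts r F V A \<pi> V' A' \<pi>' \<longleftrightarrow> (\<forall>\<chi>. (\<forall>e. \<chi> e < r) \<longrightarrow>
     (\<exists>f. f ` V \<subseteq> V' \<and> (\<forall>x. \<pi>' (f x) = \<pi> x) \<and> (\<forall>x y. (x, y) \<in> A \<longrightarrow> (f x, f y) \<in> A') \<and>
       (\<forall>x y x' y'. (x, y) \<in> A \<longrightarrow> (x', y') \<in> A \<longrightarrow> \<pi> x = \<pi> x' \<longrightarrow> \<pi> y = \<pi> y' \<longrightarrow>
          (\<pi> x, \<pi> y) \<in> F \<longrightarrow> \<chi> (f x, f y) = \<chi> (f x', f y'))))"

lemma liftsE: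
  assumes "lifts r F V A \<pi> V' A' \<pi>'" "\<forall>e. \<chi> e < r"
  obtains f where "f ` V \<subseteq> V'" "\<And>x. \<pi>' (f x) = \<pi> x"
    "\<And>x y. (x, y) \<in> A \<Longrightarrow> (f x, f y) \<in> A'"
    "\<And>x y x' y'. (x, y) \<in> A \<Longrightarrow> (x', y') \<in> A \<Longrightarrow> \<pi> x = \<pi> x' \<Longrightarrow> \<pi> y = \<pi> y' \<Longrightarrow>
       (\<pi> x, \<pi> y) \<in> F \<Longrightarrow> \<chi> (f x, f y) = \<chi> (f x', f y')"
  using assms(1)[unfolded lifts_def, THEN spec, THEN mp, OF assms(2)]
proof (elim exE conjE)
  fix f assume f: "f ` V \<subseteq> V'" "\<forall>x. \<pi>' (f x) = \<pi> x"
    "\<forall>x y. (x, y) \<in> A \<longrightarrow> (f x, f y) \<in> A'"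
    "\<forall>x y x' y'. (x, y) \<in> A \<longrightarrow> (x', y') \<in> A \<longrightarrow> \<pi> x = \<pi> x' \<longrightarrow> \<pi> y = \<pi> y' \<longrightarrow>
       (\<pi> x, \<pi> y) \<in> F \<longrightarrow> \<chi> (f x, f y) = \<chi> (f x', f y')"
  show thesis
    by (rule that[of f]) (rule f(1) f(2-)[rule_format]; assumption?)+
qed

text \<open>The map \<open>g\<close> is chosen for the given colouring, then \<open>f\<close> for
  its pullback along \<open>g\<close>. Since \<open>f\<close> respects arcs and projections, what
  \<open>g\<close> achieves over \<open>F'\<close> survives the composition.\<close>

lemma lifts_trans:
  fixes V'' :: "'z set"
  assumes f: "lifts r F V A \<pi> V' A' \<pi>'" and g: "lifts r F' V' A' \<pi>' V'' A'' \<pi>''"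
  shows "lifts r (F \<union> F') V A \<pi> V'' A'' \<pi>''"
  unfolding lifts_def
proof (intro allI impI)
  fix \<chi> :: "'z \<times> 'z \<Rightarrow> nat" assume \<chi>: "\<forall>e. \<chi> e < r"
  obtain g where g: "g ` V' \<subseteq> V''" "\<And>x. \<pi>'' (g x) = \<pi>' x"
    "\<And>x y. (x, y) \<in> A' \<Longrightarrow> (g x, g y) \<in> A''"
    "\<And>x y x' y'. (x, y) \<in> A' \<Longrightarrow> (x', y') \<in> A' \<Longrightarrow> \<pi>' x = \<pi>' x' \<Longrightarrow> \<pi>' y = \<pi>' y' \<Longrightarrow>
       (\<pi>' x, \<pi>' y) \<in> F' \<Longrightarrow> \<chi> (g x, g y) = \<chi> (g x', g y')"
    using g \<chi> by (rule liftsE) blast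
  have "\<forall>e. (\<chi> \<circ> map_prod g g) e < r" using \<chi> by simp
  with f obtain f where f: "f ` V \<subseteq> V'" "\<And>x. \<pi>' (f x) = \<pi> x"
    "\<And>x y. (x, y) \<in> A \<Longrightarrow> (f x, f y) \<in> A'"
    "\<And>x y x' y'. (x, y) \<in> A \<Longrightarrow> (x', y') \<in> A \<Longrightarrow> \<pi> x = \<pi> x' \<Longrightarrow> \<pi> y = \<pi> y' \<Longrightarrow>
       (\<pi> x, \<pi> y) \<in> F \<Longrightarrow> (\<chi> \<circ> map_prod g g) (f x, f y) = (\<chi> \<circ> map_prod g g) (f x', f y')"
    by (rule liftsE) blast
  show "\<exists>f. f ` V \<subseteq> V'' \<and> (\<forall>x. \<pi>'' (f x) = \<pi> x) \<and> (\<forall>x y. (x, y) \<in> A \<longrightarrow> (f x, f y) \<in> A'') \<and>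
       (\<forall>x y x' y'. (x, y) \<in> A \<longrightarrow> (x', y') \<in> A \<longrightarrow> \<pi> x = \<pi> x' \<longrightarrow> \<pi> y = \<pi> y' \<longrightarrow>
          (\<pi> x, \<pi> y) \<in> F \<union> F' \<longrightarrow> \<chi> (f x, f y) = \<chi> (f x', f y'))"
  proof (intro exI[of _ "g \<circ> f"] conjI allI impI)
    show "(g \<circ> f) ` V \<subseteq> V''" using f(1) g(1) by auto
    show "\<pi>'' ((g \<circ> f) x) = \<pi> x" for x using f(2) g(2) by simp
    show "((g \<circ> f) x, (g \<circ> f) y) \<in> A''" if "(x, y) \<in> A" for x y using that f(3) g(3) by simp
    fix x y x' y'
    assume *: "(x, y) \<in> A" "(x', y') \<in> A" "\<pi> x = \<pi> x'" "\<pi> y = \<pi> y'" "(\<pi> x, \<pi> y) \<in> F \<union> F'"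
    then show "\<chi> ((g \<circ> f) x, (g \<circ> f) y) = \<chi> ((g \<circ> f) x', (g \<circ> f) y')"
      using f(4)[OF *(1-4)] g(4)[OF f(3)[OF *(1)] f(3)[OF *(2)]] f(2) by auto
  qed
qed

lemma partite_step:
  fixes A D :: "(nat \<times> nat) set" and \<pi> :: "nat \<Rightarrow> nat"
  assumes A: "partite D V A \<pi>" and uw: "(u, w) \<in> D" "(w, u) \<notin> D"
    and bal: "bal p D" "bal (Suc p) A"
  shows "\<exists>V' A' \<pi>'. partite D V' A' (\<pi>' :: nat \<Rightarrow> nat) \<and> bal (Suc p) A' \<and>
    lifts r {(u, w)} V A \<pi> V' A' \<pi>'"
proof -
  have V: "finite V" "A \<subseteq> V \<times> V" and hom: "\<And>x y. (x, y) \<in> A \<Longrightarrow> (\<pi> x, \<pi> y) \<in> D"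
    using A by (auto simp: partite_def)
  define B where "B = {(x, y) \<in> A. \<pi> x = u \<and> \<pi> y = w}"
  have "finite B" by (rule finite_subset[of _ "V \<times> V"]) (use V in \<open>auto simp: B_def\<close>)
  obtain N where N: "HJ B r N" using hales_jewett[OF \<open>finite B\<close>] by blast
  define I where "I = {L. line B N L}"
  have "I \<subseteq> {L. set L \<subseteq> insert None (Some ` B) \<and> length L = N}"
    by (auto simp: I_def line_def)
  then have "finite I"
    using finite_subset finite_lists_length_eq[of "insert None (Some ` B)" N] \<open>finite B\<close> by blast
  \<comment> \<open>Coding the vertices by natural numbers keeps the type fixed, so that the step
    can be iterated. The first component of the decoded vertex is its projection.\<close>
  define \<phi> where "\<phi> L x = to_nat (place u w \<pi> L x)" for L x
  define \<pi>' where
    "\<pi>' z = fst (from_nat z :: nat \<times> (nat list + (nat \<times> nat) option list \<times> nat))" for z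
  have \<phi>_eq: "\<phi> L x = \<phi> L' y \<longleftrightarrow> place u w \<pi> L x = place u w \<pi> L' y" for L L' x y
    by (simp add: \<phi>_def)
  have proj: "\<pi>' (\<phi> L x) = \<pi> x" for L x
    by (simp add: \<phi>_def \<pi>'_def place_def)
  have I: "None \<in> set L" "set L \<subseteq> insert None (Some ` B)" if "L \<in> I" for L
    using that by (auto simp: I_def line_def)
  interpret amalgam A D \<pi> I \<phi> \<pi>' u w
  proof
    show "x = y" if "L \<in> I" "\<phi> L x = \<phi> L y" for L x y
      using that(2) coord_inj[OF I(1)[OF that(1)]] unfolding \<phi>_eq place_def
      by (auto split: if_splits)
    show "L = L'" if "\<phi> L x = \<phi> L' y" "\<pi> x \<noteq> u" "\<pi> x \<noteq> w" for L L' x y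
      using that unfolding \<phi>_eq place_def by (auto split: if_splits)
    show "(x, y) \<in> A" if "L \<in> I" "L' \<in> I" "\<phi> L x = \<phi> L' a" "\<phi> L y = \<phi> L' b"
      "\<pi> x = u" "\<pi> y = w" "(a, b) \<in> A" for L L' x y a b
    proof -
      have "u \<noteq> w" using uw by auto
      have ab: "\<pi> a = u" "\<pi> b = w" using that(3-6) proj by metis+
      have eq: "coord fst L x = coord fst L' a" "coord snd L y = coord snd L' b"
        using that(3,4) \<open>u \<noteq> w\<close> unfolding \<phi>_eq place_def that(5,6) ab by simp_all
      have "(a, b) \<in> B" using that ab by (simp add: B_def)
      then have "(x, y) \<in> B" using coord_arc[OF I(1) I(2)] that(1,2) eq by blast
      then show ?thesis by (simp add: B_def)
    qed
  qed (use hom uw proj in auto)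
  let ?V = "\<Union>L\<in>I. \<phi> L ` V"
  have "partite D ?V arcs \<pi>'"
    using \<open>finite I\<close> V arcs_hom unfolding partite_def by (auto simp: arcs_def)
  moreover have "lifts r {(u, w)} V A \<pi> ?V arcs \<pi>'"
    unfolding lifts_def
  proof (intro allI impI)
    fix \<chi> :: "nat \<times> nat \<Rightarrow> nat" assume \<chi>: "\<forall>e. \<chi> e < r"
    define word :: "nat \<Rightarrow> nat list \<Rightarrow> nat"
      where "word h v = to_nat (h, Inl v :: nat list + (nat \<times> nat) option list \<times> nat)" for h v
    \<comment> \<open>A word of arcs stands for the pair of its tail word and its head word. So
      \<open>\<chi>\<close> colours words, and the image of \<open>(x, y)\<close> in copy
      \<open>L\<close> is the point of the line \<open>L\<close> at the letter
      \<open>(x, y)\<close>.\<close>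
    let ?\<chi> = "\<lambda>v. \<chi> (word u (map fst v), word w (map snd v))"
    have "\<forall>v. ?\<chi> v < r" using \<chi> by simp
    then obtain L where L: "line B N L" "mono_line ?\<chi> B L" 
      using N[unfolded HJ_def, THEN spec[of _ ?\<chi>]] by blast
    have "u \<noteq> w" using uw by auto
    then have col: "\<chi> (\<phi> L x, \<phi> L y) = ?\<chi> (inst L (x, y))" if "\<pi> x = u" "\<pi> y = w" for x y
      using that by (simp add: \<phi>_def place_def word_def coord_inst)
    have same: "\<chi> (\<phi> L x, \<phi> L y) = \<chi> (\<phi> L x', \<phi> L y')"
      if "(x, y) \<in> A" "(x', y') \<in> A" "\<pi> x = u" "\<pi> y = w" "\<pi> x' = u" "\<pi> y' = w" for x y x' y'
    proof -
      have "(x, y) \<in> B" "(x', y') \<in> B" using that by (auto simp: B_def)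
      then have "?\<chi> (inst L (x, y)) = ?\<chi> (inst L (x', y'))"
        using L(2) unfolding mono_line_def by blast
      then show ?thesis using col that by simp
    qed
    have "L \<in> I" using L by (simp add: I_def)
    show "\<exists>f. f ` V \<subseteq> ?V \<and> (\<forall>x. \<pi>' (f x) = \<pi> x) \<and>
        (\<forall>x y. (x, y) \<in> A \<longrightarrow> (f x, f y) \<in> arcs) \<and>
        (\<forall>x y x' y'. (x, y) \<in> A \<longrightarrow> (x', y') \<in> A \<longrightarrow> \<pi> x = \<pi> x' \<longrightarrow> \<pi> y = \<pi> y' \<longrightarrow>
          (\<pi> x, \<pi> y) \<in> {(u, w)} \<longrightarrow> \<chi> (f x, f y) = \<chi> (f x', f y'))"
    proof (intro exI[of _ "\<phi> L"] conjI allI impI)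
      show "\<phi> L ` V \<subseteq> ?V" using \<open>L \<in> I\<close> by blast
      show "\<pi>' (\<phi> L x) = \<pi> x" for x using \<open>L \<in> I\<close> by (rule proj)
      show "(\<phi> L x, \<phi> L y) \<in> arcs" if "(x, y) \<in> A" for x y
        using that \<open>L \<in> I\<close> unfolding arcs_def by blast
      fix x y x' y'
      assume xy: "(x, y) \<in> A" "(x', y') \<in> A" and eq: "\<pi> x = \<pi> x'" "\<pi> y = \<pi> y'"
        and "(\<pi> x, \<pi> y) \<in> {(u, w)}"
      then have "\<pi> x = u" "\<pi> y = w" by blast+
      then show "\<chi> (\<phi> L x, \<phi> L y) = \<chi> (\<phi> L x', \<phi> L y')"
        using same[OF xy] unfolding eq by blast
    qed
  qed
  ultimately show ?thesis using bal_arcs[OF bal]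
    by (intro exI[of _ ?V] exI[of _ arcs] exI[of _ \<pi>']) simp
qed

text \<open>One amalgamation per arc of \<open>F\<close>; by \<open>lifts_trans\<close> the arcs
  treated earlier stay treated.\<close>

lemma partite_construction:
  fixes A0 D :: "(nat \<times> nat) set" and \<pi>0 :: "nat \<Rightarrow> nat"
  assumes A0: "partite D V0 A0 \<pi>0"
    and asym: "\<And>x y. (x, y) \<in> D \<Longrightarrow> (y, x) \<notin> D"
    and bal: "bal p D" "bal (Suc p) A0"
    and F: "finite F" "F \<subseteq> D"
  shows "\<exists>V A \<pi>. partite D V A (\<pi> :: nat \<Rightarrow> nat) \<and> bal (Suc p) A \<and> lifts r F V0 A0 \<pi>0 V A \<pi>"
  using F
proof (induction F rule: finite_induct)
  case empty
  have "lifts r {} V0 A0 \<pi>0 V0 A0 \<pi>0"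
    unfolding lifts_def by (intro allI impI exI[of _ "\<lambda>x. x"]) simp
  then show ?case using A0 bal by blast
next
  case (insert e F)
  obtain u w where e: "e = (u, w)" by fastforce
  then have uw: "(u, w) \<in> D" "(w, u) \<notin> D" using insert.prems asym by auto
  obtain V A and \<pi> :: "nat \<Rightarrow> nat" where
    A: "partite D V A \<pi>" "bal (Suc p) A" "lifts r F V0 A0 \<pi>0 V A \<pi>"
    using insert.IH insert.prems by blast
  obtain V' A' and \<pi>' :: "nat \<Rightarrow> nat" where
    "partite D V' A' \<pi>'" "bal (Suc p) A'" "lifts r {(u, w)} V A \<pi> V' A' \<pi>'"
    using partite_step[OF A(1) uw bal(1) A(2)] by blast
  then show ?case using lifts_trans[OF A(3)] e by (metis Un_insert_right sup_bot_right)
qed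

section \<open>Ordered Ramsey digraphs on initial segments of the naturals, by induction on
  \<open>p\<close>\<close>

definition arrows :: "nat \<Rightarrow> nat \<Rightarrow> (nat \<times> nat) set \<Rightarrow> nat \<Rightarrow> (nat \<times> nat) set \<Rightarrow> bool" where
  "arrows r n E M D \<longleftrightarrow> (\<forall>\<chi>. (\<forall>e. \<chi> e < r) \<longrightarrow>
     (\<exists>g c. strict_mono_on {..<n} g \<and> g ` {..<n} \<subseteq> {..<M} \<and>
        (\<forall>x y. (x, y) \<in> E \<longrightarrow> (g x, g y) \<in> D \<and> \<chi> (g x, g y) = (c::nat))))"

definition ascending :: "nat \<Rightarrow> (nat \<times> nat) set \<Rightarrow> bool" where
  "ascending n E \<longleftrightarrow> (\<forall>x y. (x, y) \<in> E \<longrightarrow> x < y \<and> y < n)"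

text \<open>A homogeneous set of size \<open>n\<close>, enumerated increasingly, contains every
  ascending digraph on \<open>n\<close> vertices.\<close>

lemma ramsey_pairs:
  assumes E: "ascending n E"
  shows "\<exists>M. arrows r n E M {(x, y). x < y \<and> y < M}"
proof -
  obtain M :: nat where M: "partn_lst {..<M} (replicate r n) 2"
    using ramsey_full[of "replicate r n" 2] by auto
  have "arrows r n E M {(x, y). x < y \<and> y < M}"
    unfolding arrows_def
  proof (intro allI impI)
    fix \<chi> :: "nat \<times> nat \<Rightarrow> nat" assume \<chi>: "\<forall>e. \<chi> e < r"
    have "(\<lambda>X. \<chi> (Min X, Max X)) \<in> nsets {..<M} 2 \<rightarrow> {..<r}" using \<chi> by auto
    from partn_lstE[OF M this] obtain c Z where Z: "c < r" "Z \<in> nsets {..<M} n"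
      and mono: "(\<lambda>X. \<chi> (Min X, Max X)) ` nsets Z 2 \<subseteq> {c}"
      by (metis length_replicate nth_replicate)
    let ?g = "\<lambda>i. sorted_list_of_set Z ! i"
    have fin: "finite Z" "card Z = n" "Z \<subseteq> {..<M}" using Z by (auto simp: nsets_def)
    then have len: "length (sorted_list_of_set Z) = n" by simp
    have less: "?g i < ?g j" if "i < j" "j < n" for i j
      using that len strict_sorted_list_of_set[of Z] sorted_wrt_nth_less by metis
    have gZ: "?g i \<in> Z" if "i < n" for i
      using that len fin nth_mem set_sorted_list_of_set by metis
    have "\<chi> (?g x, ?g y) = c \<and> (?g x, ?g y) \<in> {(x, y). x < y \<and> y < M}" if "(x, y) \<in> E" for x y
    proof -
      have xy: "x < y" "y < n" using E that by (auto simp: ascending_def)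
      then have *: "?g x < ?g y" "?g x \<in> Z" "?g y \<in> Z" using less gZ by auto
      then have "{?g x, ?g y} \<in> nsets Z 2" by (simp add: nsets_def)
      then have "\<chi> (Min {?g x, ?g y}, Max {?g x, ?g y}) = c" using mono by blast
      then show ?thesis using * fin by auto
    qed
    moreover have "strict_mono_on {..<n} ?g" by (auto simp: strict_mono_on_def less)
    moreover have "?g ` {..<n} \<subseteq> {..<M}" using gZ fin by auto
    ultimately show "\<exists>g c. strict_mono_on {..<n} g \<and> g ` {..<n} \<subseteq> {..<M} \<and>
        (\<forall>x y. (x, y) \<in> E \<longrightarrow> (g x, g y) \<in> {(x, y). x < y \<and> y < M} \<and> \<chi> (g x, g y) = c)"
      by (intro exI[of _ ?g] exI[of _ c]) blast
  qed
  then show ?thesis ..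
qed

lemma arrows_Suc:
  assumes E: "ascending n E" "bal (Suc p) E" and D: "ascending M D" "bal p D" "arrows r n E M D"
    and r: "0 < r"
  shows "\<exists>M' D'. ascending M' D' \<and> bal (Suc p) D' \<and> arrows r n E M' D'"
proof -
  \<comment> \<open>All homomorphisms from \<open>E\<close> to \<open>D\<close>, written as lists of
    values; the increasing ones are the copies of the given graph in \<open>D\<close>.\<close>
  define S where "S = {gs :: nat list. set gs \<subseteq> {..<M} \<and> length gs = n \<and>
     (\<forall>x y. (x, y) \<in> E \<longrightarrow> (gs ! x, gs ! y) \<in> D)}"
  have "S \<subseteq> {gs. set gs \<subseteq> {..<M} \<and> length gs = n}" by (auto simp: S_def)
  then have "finite S" using finite_subset finite_lists_length_eq[of "{..<M}" n] by blast
  \<comment> \<open>Tagging each vertex with its homomorphism makes the copies disjoint;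
    \<open>\<pi>0\<close> evaluates the tag at the vertex.\<close>
  define V0 where "V0 = to_nat ` (S \<times> {..<n})"
  define A0 where "A0 = {(to_nat (gs, x), to_nat (gs, y)) |gs x y. gs \<in> S \<and> (x, y) \<in> E}"
  define \<pi>0 where "\<pi>0 z = (case from_nat z of (gs :: nat list, x) \<Rightarrow> gs ! x)" for z
  have \<pi>0: "\<pi>0 (to_nat (gs, x)) = gs ! x" for gs x by (simp add: \<pi>0_def)
  have "finite V0" using \<open>finite S\<close> by (simp add: V0_def)
  moreover have "A0 \<subseteq> V0 \<times> V0" using E by (fastforce simp: A0_def V0_def ascending_def)
  moreover have "(\<pi>0 x, \<pi>0 y) \<in> D" if "(x, y) \<in> A0" for x y
    using that by (auto simp: A0_def S_def \<pi>0)
  ultimately have P0: "partite D V0 A0 \<pi>0" by (simp add: partite_def)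
  have asym: "(y, x) \<notin> D" if "(x, y) \<in> D" for x y
    using D(1) that unfolding ascending_def by (meson less_asym)
  \<comment> \<open>Forgetting the tag is a homomorphism to \<open>E\<close>.\<close>
  have bal0: "bal (Suc p) A0"
    by (rule bal_hom[where f = "\<lambda>z. snd (from_nat z :: nat list \<times> nat)", OF _ E(2)])
       (auto simp: A0_def)
  have "D \<subseteq> {..<M} \<times> {..<M}" using D(1) by (fastforce simp: ascending_def)
  then have "finite D" by (rule finite_subset) simp
  then obtain V A and \<pi> :: "nat \<Rightarrow> nat" where P: "partite D V A \<pi>"
    and balA: "bal (Suc p) A" and lifts: "lifts r D V0 A0 \<pi>0 V A \<pi>"
    using partite_construction[OF P0 asym D(2) bal0, of D r] by blast
  have V: "finite V" "A \<subseteq> V \<times> V" and hom: "\<forall>x y. (x, y) \<in> A \<longrightarrow> (\<pi> x, \<pi> y) \<in> D"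
    using P by (auto simp: partite_def)
  obtain K where K: "\<And>x. x \<in> V \<Longrightarrow> x < K"
    using V(1) unfolding finite_nat_set_iff_bounded by blast
  \<comment> \<open>Lexicographic renumbering, first by projection and then by name: arcs ascend
    because their projections do, and \<open>mod K\<close> recovers the name.\<close>
  define \<iota> where "\<iota> x = \<pi> x * K + x" for x
  have \<iota>_less: "\<iota> x < \<iota> y" if "\<pi> x < \<pi> y" "x \<in> V" for x y
  proof -
    have "\<iota> x < Suc (\<pi> x) * K" using K[OF that(2)] by (simp add: \<iota>_def)
    also have "\<dots> \<le> \<pi> y * K" using that by (intro mult_le_mono1) simp
    finally show ?thesis by (simp add: \<iota>_def)
  qed
  have \<iota>_mod: "\<iota> x mod K = x" if "x \<in> V" for x using K[OF that] by (simp add: \<iota>_def)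
  obtain M' where "\<forall>z\<in>\<iota> ` V. z < M'"
    using finite_imageI[OF V(1), of \<iota>] unfolding finite_nat_set_iff_bounded by blast
  then have M': "\<iota> x < M'" if "x \<in> V" for x using that by simp
  define D' where "D' = map_prod \<iota> \<iota> ` A"
  have "ascending M' D'"
    unfolding ascending_def
  proof (intro allI impI)
    fix a b assume "(a, b) \<in> D'"
    then obtain x y where xy: "(x, y) \<in> A" "a = \<iota> x" "b = \<iota> y" by (auto simp: D'_def)
    then have "x \<in> V" "y \<in> V" using V(2) by auto
    moreover have "\<pi> x < \<pi> y" using xy hom D(1) unfolding ascending_def by blast
    ultimately show "a < b \<and> b < M'" using \<iota>_less M' xy by simp
  qed
  moreover have "bal (Suc p) D'"
    by (rule bal_hom[where f = "\<lambda>z. z mod K", OF _ balA])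
       (use V(2) \<iota>_mod in \<open>auto simp: D'_def\<close>)
  moreover have "arrows r n E M' D'"
    unfolding arrows_def
  proof (intro allI impI)
    fix \<chi> :: "nat \<times> nat \<Rightarrow> nat" assume \<chi>: "\<forall>e. \<chi> e < r"
    then have "\<forall>e. (\<chi> \<circ> map_prod \<iota> \<iota>) e < r" by simp
    with lifts obtain f where f: "f ` V0 \<subseteq> V" "\<And>x. \<pi> (f x) = \<pi>0 x"
      "\<And>x y. (x, y) \<in> A0 \<Longrightarrow> (f x, f y) \<in> A"
      "\<And>x y x' y'. (x, y) \<in> A0 \<Longrightarrow> (x', y') \<in> A0 \<Longrightarrow> \<pi>0 x = \<pi>0 x' \<Longrightarrow> \<pi>0 y = \<pi>0 y' \<Longrightarrow>
        (\<pi>0 x, \<pi>0 y) \<in> D \<Longrightarrow>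
        (\<chi> \<circ> map_prod \<iota> \<iota>) (f x, f y) = (\<chi> \<circ> map_prod \<iota> \<iota>) (f x', f y')"
      by (rule liftsE) blast
    \<comment> \<open>The lifting property makes the colours of the copies descend to a colouring of
      \<open>D\<close>. An arc of \<open>D\<close> is coloured through a chosen preimage; without a
      preimage its colour is arbitrary but still below \<open>r\<close>.\<close>
    have "\<exists>\<psi>. (\<forall>d. \<psi> d < r) \<and> (\<forall>x y. (x, y) \<in> A0 \<longrightarrow> (\<pi>0 x, \<pi>0 y) \<in> D \<longrightarrow>
        \<psi> (\<pi>0 x, \<pi>0 y) = \<chi> (\<iota> (f x), \<iota> (f y)))"
    proof -
      let ?\<psi> = "\<lambda>d. case (SOME a. a \<in> A0 \<and> map_prod \<pi>0 \<pi>0 a = d) of (x, y) \<Rightarrow> \<chi> (\<iota> (f x), \<iota> (f y))"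
      have "?\<psi> (\<pi>0 x, \<pi>0 y) = \<chi> (\<iota> (f x), \<iota> (f y))" if "(x, y) \<in> A0" "(\<pi>0 x, \<pi>0 y) \<in> D" for x y
      proof -
        obtain x' y' where *: "(SOME a. a \<in> A0 \<and> map_prod \<pi>0 \<pi>0 a = (\<pi>0 x, \<pi>0 y)) = (x', y')"
          by fastforce
        have "(x', y') \<in> A0 \<and> map_prod \<pi>0 \<pi>0 (x', y') = (\<pi>0 x, \<pi>0 y)"
          unfolding *[symmetric] by (rule someI[of _ "(x, y)"]) (use that in simp)
        then show ?thesis using f(4)[of x' y' x y] that * by simp
      qed
      moreover have "\<forall>d. ?\<psi> d < r" using \<chi> by (auto split: prod.split)
      ultimately show ?thesis by (intro exI[of _ ?\<psi>]) blast
    qed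
    then obtain \<psi> where \<psi>: "\<forall>d. \<psi> d < r" "\<And>x y. (x, y) \<in> A0 \<Longrightarrow> (\<pi>0 x, \<pi>0 y) \<in> D \<Longrightarrow>
        \<psi> (\<pi>0 x, \<pi>0 y) = \<chi> (\<iota> (f x), \<iota> (f y))" by blast
    obtain g c where g: "strict_mono_on {..<n} g" "g ` {..<n} \<subseteq> {..<M}"
      "\<And>x y. (x, y) \<in> E \<Longrightarrow> (g x, g y) \<in> D \<and> \<psi> (g x, g y) = c"
      using D(3) \<psi>(1) unfolding arrows_def by blast
    \<comment> \<open>The copy of the graph that is monochromatic under \<open>\<psi>\<close> is
      itself a tag in \<open>S\<close>. The part of \<open>V0\<close> with this tag is thus sent to
      a monochromatic copy, ordered as its projection \<open>g\<close>.\<close>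
    let ?gs = "map g [0..<n]"
    have En: "x < n" "y < n" if "(x, y) \<in> E" for x y
      using E(1) that unfolding ascending_def by (auto intro: less_trans)
    have gs: "?gs \<in> S" using g(2,3) En by (simp add: S_def image_subset_iff lessThan_atLeast0)
    let ?h = "\<lambda>x. f (to_nat (?gs, x))"
    have hV: "?h x \<in> V" if "x < n" for x using f(1) gs that by (auto simp: V0_def)
    have \<pi>h: "\<pi> (?h x) = g x" if "x < n" for x using f(2) \<pi>0 that by simp
    have "strict_mono_on {..<n} (\<lambda>x. \<iota> (?h x))"
      using g(1) \<iota>_less hV \<pi>h unfolding strict_mono_on_def by simp
    moreover have "(\<lambda>x. \<iota> (?h x)) ` {..<n} \<subseteq> {..<M'}" using M' hV by auto
    moreover have "(\<iota> (?h x), \<iota> (?h y)) \<in> D' \<and> \<chi> (\<iota> (?h x), \<iota> (?h y)) = c" if "(x, y) \<in> E" for x y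
    proof -
      have a: "(to_nat (?gs, x), to_nat (?gs, y)) \<in> A0" using gs that by (auto simp: A0_def)
      then have "(\<iota> (?h x), \<iota> (?h y)) \<in> D'"
        using imageI[OF f(3)[OF a], of "map_prod \<iota> \<iota>"] by (simp add: D'_def)
      then show ?thesis
        using \<psi>(2)[OF a] g(3)[OF that] En[OF that] by (simp add: \<pi>0)
    qed
    ultimately show "\<exists>g c. strict_mono_on {..<n} g \<and> g ` {..<n} \<subseteq> {..<M'} \<and>
        (\<forall>x y. (x, y) \<in> E \<longrightarrow> (g x, g y) \<in> D' \<and> \<chi> (g x, g y) = c)"
      by (intro exI[of _ "\<lambda>x. \<iota> (?h x)"] exI[of _ c]) blast
  qed
  ultimately show ?thesis by blast
qed

text \<open>For \<open>p = 0\<close> the balance condition is void, so the transitive tournament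
  from Ramsey's theorem starts the induction.\<close>

lemma arrows_bal:
  assumes E: "ascending n E" "bal p E" and r: "0 < r"
  shows "\<exists>M D. ascending M D \<and> bal p D \<and> arrows r n E M D"
  using E(2)
proof (induction p)
  case 0
  obtain M where "arrows r n E M {(x, y). x < y \<and> y < M}" using ramsey_pairs[OF E(1)] by blast
  moreover have "ascending M {(x, y). x < y \<and> y < M}" by (simp add: ascending_def)
  ultimately show ?case using bal_0 by blast
next
  case (Suc p)
  then have "bal p E" using bal_mono[of "Suc p" E p] by simp
  then obtain M D where "ascending M D" "bal p D" "arrows r n E M D" using Suc.IH by blast
  from arrows_Suc[OF E(1) Suc.prems this r] show ?case .
qed

section \<open>Ordered graphs\<close>

text \<open>Walks as indexed sequences of vertices and signs, the form in which they are compared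
  with circuits.\<close>

lemma walk_steps:
  assumes "walk A x n b y"
  shows "\<exists>f s. f 0 = x \<and> f n = y \<and> (\<forall>i<n. step A (s i) (f i) (f (Suc i))) \<and> b = (\<Sum>i<n. s i)"
  using assms
proof induction
  case (Nil x)
  show ?case by (rule exI[of _ "\<lambda>_. x"]) simp
next
  case (Cons s x y n b z)
  then obtain f t where "f 0 = y" "f n = z" "\<forall>i<n. step A (t i) (f i) (f (Suc i))"
    "b = (\<Sum>i<n. t i)" by blast
  then show ?case using Cons.hyps(1)
    by (intro exI[of _ "case_nat x f"] exI[of _ "case_nat s t"])
       (auto simp: sum.lessThan_Suc_shift split: nat.split simp del: sum.lessThan_Suc)
qed

lemma walk_of_steps:
  assumes "\<And>i. i < n \<Longrightarrow> step A (s i) (f i) (f (Suc i))"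
  shows "walk A (f 0) n (\<Sum>i<n. s i) (f n)"
  using assms
proof (induction n)
  case 0
  show ?case by (simp add: walk.Nil)
next
  case (Suc n)
  have "walk A (f 0) (n + 1) ((\<Sum>i<n. s i) + s n) (f (Suc n))"
    by (rule walk_append[OF Suc.IH walk_single]) (use Suc.prems in auto)
  then show ?case by simp
qed

definition darcs :: "'a ordered_graph \<Rightarrow> ('a \<times> 'a) set" where
  "darcs G = {(x, y) \<in> less_rel G. {x, y} \<in> edges G}"

context
  fixes G :: "'a ordered_graph"
  assumes G: "ordered_graph G"
begin

lemma finite_verts: "finite (verts G)"
  using G by (simp add: ordered_graph_def)

lemma vless_verts: "(x, y) \<in> less_rel G \<Longrightarrow> x \<in> verts G \<and> y \<in> verts G"
  using G by (auto simp: ordered_graph_def)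

lemma vless_trans: "(x, y) \<in> less_rel G \<Longrightarrow> (y, z) \<in> less_rel G \<Longrightarrow> (x, z) \<in> less_rel G"
  using G unfolding ordered_graph_def strict_linear_order_on_def by (meson transD)

lemma vless_irrefl: "(x, x) \<notin> less_rel G"
  using G unfolding ordered_graph_def strict_linear_order_on_def by (meson irreflD)

lemma vless_asym: "(x, y) \<in> less_rel G \<Longrightarrow> (y, x) \<notin> less_rel G"
  using vless_trans vless_irrefl by blast

lemma vless_total:
  "x \<in> verts G \<Longrightarrow> y \<in> verts G \<Longrightarrow> x \<noteq> y \<Longrightarrow> (x, y) \<in> less_rel G \<or> (y, x) \<in> less_rel G"
  using G unfolding ordered_graph_def strict_linear_order_on_def total_on_def by blast

lemma edge_verts: "e \<in> edges G \<Longrightarrow> e \<subseteq> verts G" "e \<in> edges G \<Longrightarrow> card e = 2"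
  using G by (auto simp: ordered_graph_def)

lemma edge_less:
  assumes "{x, y} \<in> edges G" shows "(x, y) \<in> less_rel G \<or> (y, x) \<in> less_rel G"
proof -
  have "x \<noteq> y" using edge_verts(2)[OF assms] by auto
  then show ?thesis using vless_total edge_verts(1)[OF assms] by auto
qed

lemma step_darcs:
  "step (darcs G) s x y \<longleftrightarrow>
     {x, y} \<in> edges G \<and> s = (if (x, y) \<in> less_rel G then 1 else -1)"
  using edge_less vless_asym by (auto simp: step_def darcs_def insert_commute)

lemma balanced_iff:
  assumes "circuit G c"
  shows "balanced G c \<longleftrightarrow> (\<Sum>i<length c.
    if (c ! i, c ! (Suc i mod length c)) \<in> less_rel G then 1 else -1 :: int) = 0"
proof -
  let ?F = "{i. i < length c \<and> (c ! i, c ! (Suc i mod length c)) \<in> less_rel G}"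
  let ?B = "{i. i < length c \<and> (c ! (Suc i mod length c), c ! i) \<in> less_rel G}"
  have e: "{c ! i, c ! (Suc i mod length c)} \<in> edges G" if "i < length c" for i
    using assms that by (simp add: circuit_def)
  have F: "?F = {..<length c} \<inter> {i. (c ! i, c ! (Suc i mod length c)) \<in> less_rel G}"
    by auto
  have B: "?B = {..<length c} \<inter> - {i. (c ! i, c ! (Suc i mod length c)) \<in> less_rel G}"
    using e edge_less vless_asym by blast
  have "(\<Sum>i<length c. if (c ! i, c ! (Suc i mod length c)) \<in> less_rel G then 1 else -1 :: int) =
      int (card ?F) - int (card ?B)"
    unfolding F B by (simp add: sum.If_cases)
  then show ?thesis by (simp add: balanced_def)
qed

lemma BalI:
  assumes "bal p (darcs G)" shows "G \<in> Bal p"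
proof -
  have "balanced G c" if c: "circuit G c" "length c \<le> p" for c
  proof -
    let ?n = "length c"
    have "?n > 0" using c by (auto simp: circuit_def)
    \<comment> \<open>The circuit is traversed by \<open>c ! (i mod ?n)\<close>, so that the final
      index \<open>?n\<close> wraps round to the start.\<close>
    have "step (darcs G) (if (c ! i, c ! (Suc i mod ?n)) \<in> less_rel G then 1 else -1)
        (c ! (i mod ?n)) (c ! (Suc i mod ?n))" if "i < ?n" for i
      using c that by (simp add: step_darcs circuit_def)
    then have "walk (darcs G) (c ! (0 mod ?n)) ?n
        (\<Sum>i<?n. if (c ! i, c ! (Suc i mod ?n)) \<in> less_rel G then 1 else -1) (c ! (?n mod ?n))"
      by (rule walk_of_steps)
    then have "(\<Sum>i<?n. if (c ! i, c ! (Suc i mod ?n)) \<in> less_rel G then 1 else -1 :: int) = 0"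
      using balD[OF assms _ c(2)] by simp
    then show ?thesis by (simp add: balanced_iff[OF c(1)])
  qed
  then show ?thesis using G by (auto simp: Bal_def)
qed

text \<open>A closed walk with a repeated vertex splits into two shorter closed walks.\<close>

lemma BalD:
  assumes "G \<in> Bal p" shows "bal p (darcs G)"
  unfolding bal_def
proof (intro allI impI)
  fix x n b assume "walk (darcs G) x n b x" "n \<le> p"
  then show "b = 0"
  proof (induction n arbitrary: x b rule: less_induct)
    case (less n)
    obtain f s where f: "f 0 = x" "f n = x" and st: "\<forall>i<n. step (darcs G) (s i) (f i) (f (Suc i))"
      and b: "b = (\<Sum>i<n. s i)"
      using walk_steps[OF less.prems(1)] by blast
    have e: "{f i, f (Suc i)} \<in> edges G"
        "s i = (if (f i, f (Suc i)) \<in> less_rel G then 1 else -1)" if "i < n" for i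
      using st that by (auto simp: step_darcs)
    show ?case
    proof (cases "inj_on f {..<n}")
      case True
      \<comment> \<open>Without repeated vertices, length 1 would be a loop, length 2 runs to and
        fro along one edge with cancelling signs, and from length 3 on the walk is a
        circuit.\<close>
      consider "n = 0" | "n = 1" | "n = 2" | "3 \<le> n" by linarith
      then show ?thesis
      proof cases
        case 1
        then show ?thesis using b by simp
      next
        case 2
        then show ?thesis using e(1)[of 0] edge_verts(2) f by fastforce
      next
        case 3
        then have "f (Suc (Suc 0)) = f 0" using f by (simp add: numeral_2_eq_2)
        then show ?thesis using 3 b e[of 0] e[of 1] edge_less vless_asym
          by (auto simp: numeral_2_eq_2)
      next
        case 4
        let ?c = "map f [0..<n]"
        have c: "?c ! (Suc i mod n) = f (Suc i)" if "i < n" for i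
          using that f by (cases "Suc i = n") auto
        have "f i \<in> verts G" if "i < n" for i using edge_verts(1)[OF e(1)[OF that]] by simp
        then have "circuit G ?c"
          using 4 True e c by (auto simp: circuit_def distinct_map lessThan_atLeast0)
        moreover from this have "balanced G ?c"
          using assms less.prems(2) by (auto simp: Bal_def)
        ultimately have "(\<Sum>i<n. if (f i, ?c ! (Suc i mod n)) \<in> less_rel G then 1 else -1 :: int) = 0"
          by (simp add: balanced_iff)
        moreover have "b = (\<Sum>i<n. if (f i, ?c ! (Suc i mod n)) \<in> less_rel G then 1 else -1)"
          unfolding b using e(2) c by (intro sum.cong) auto
        ultimately show ?thesis by simp
      qed
    next
      case False
      then obtain i j where ij: "i < j" "j < n" "f i = f j"
        unfolding inj_on_def by (metis lessThan_iff linorder_neqE_nat)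
      have seg: "walk (darcs G) (f k) (l - k) (sum s {k..<l}) (f l)" if "k \<le> l" "l \<le> n" for k l
      proof -
        have "sum s {k..<l} = (\<Sum>i<l - k. s (k + i))"
          by (rule sum.reindex_bij_witness[of _ "\<lambda>i. k + i" "\<lambda>i. i - k"]) auto
        then show ?thesis
          using walk_of_steps[of "l - k" "darcs G" "\<lambda>i. s (k + i)" "\<lambda>i. f (k + i)"] st that by simp
      qed
      have "sum s {i..<j} = 0"
        using less.IH[of "j - i" "f i"] seg[of i j] ij less.prems(2) by simp
      moreover have "walk (darcs G) x (i + (n - j)) (sum s {0..<i} + sum s {j..<n}) x"
        using walk_append seg[of 0 i] seg[of j n] ij f by fastforce
      then have "sum s {0..<i} + sum s {j..<n} = 0"
        using less.IH[of "i + (n - j)" x] ij less.prems(2) by simp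
      moreover have "b = sum s {0..<i} + sum s {i..<j} + sum s {j..<n}"
        using ij by (simp add: b lessThan_atLeast0 sum.atLeastLessThan_concat)
      ultimately show ?thesis by simp
    qed
  qed
qed

end

section \<open>Renumbering the vertices in their order, and the return to ordered graphs\<close>

definition rank :: "'a ordered_graph \<Rightarrow> 'a \<Rightarrow> nat" where
  "rank G v = card {x \<in> verts G. (x, v) \<in> less_rel G}"

lemma rank_less:
  assumes G: "ordered_graph G" and xy: "(x, y) \<in> less_rel G"
  shows "rank G x < rank G y" "rank G y < card (verts G)"
proof -
  have "{z \<in> verts G. (z, x) \<in> less_rel G} \<subset> {z \<in> verts G. (z, y) \<in> less_rel G}"
    using xy vless_trans[OF G] vless_irrefl[OF G] vless_verts[OF G] by blast
  then show "rank G x < rank G y"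
    unfolding rank_def using finite_verts[OF G] by (intro psubset_card_mono) auto
  have "{z \<in> verts G. (z, y) \<in> less_rel G} \<subset> verts G"
    using xy vless_irrefl[OF G] vless_verts[OF G] by blast
  then show "rank G y < card (verts G)"
    unfolding rank_def using finite_verts[OF G] by (intro psubset_card_mono) auto
qed

lemma rank_lt_card:
  assumes G: "ordered_graph G" and "v \<in> verts G"
  shows "rank G v < card (verts G)"
proof -
  have "{z \<in> verts G. (z, v) \<in> less_rel G} \<subset> verts G"
    using assms vless_irrefl[OF G] by blast
  then show ?thesis
    unfolding rank_def using finite_verts[OF G] by (intro psubset_card_mono) auto
qed

definition graph_of :: "nat \<Rightarrow> (nat \<times> nat) set \<Rightarrow> nat ordered_graph" where
  "graph_of M D = \<lparr>verts = {..<M}, edges = (\<lambda>(x, y). {x, y}) ` D,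
     less_rel = {(x, y). x < y \<and> y < M}\<rparr>"

lemma ordered_graph_graph_of:
  assumes "ascending M D" shows "ordered_graph (graph_of M D)"
proof -
  have "x < M" "y < M" "card {x, y} = 2" if "(x, y) \<in> D" for x y
    using assms that by (fastforce simp: ascending_def)+
  then show ?thesis
    unfolding ordered_graph_def strict_linear_order_on_def graph_of_def
    by (auto simp: trans_def irrefl_def total_on_def)
qed

lemma darcs_graph_of: "ascending M D \<Longrightarrow> darcs (graph_of M D) = D"
  unfolding ascending_def darcs_def graph_of_def by (fastforce simp: doubleton_eq_iff)

lemma subgraphI:
  assumes H: "ordered_graph H" and K: "verts K \<subseteq> verts H" "edges K \<subseteq> edges H"
    "\<And>e. e \<in> edges K \<Longrightarrow> e \<subseteq> verts K" "less_rel K = less_rel H \<inter> verts K \<times> verts K"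
  shows "subgraph K H"
proof -
  have "trans (less_rel K)"
    unfolding K(4) using vless_trans[OF H] by (blast intro: transI)
  moreover have "irrefl (less_rel K)"
    unfolding K(4) using vless_irrefl[OF H] by (blast intro: irreflI)
  moreover have "total_on (verts K) (less_rel K)"
    unfolding K(4) total_on_def using vless_total[OF H] K(1) by blast
  moreover have "finite (verts K)" using finite_subset[OF K(1) finite_verts[OF H]] .
  ultimately have "ordered_graph K"
    using K edge_verts(2)[OF H] unfolding ordered_graph_def strict_linear_order_on_def by blast
  then show ?thesis using H K by (simp add: subgraph_def)
qed

definition map_graph :: "('a \<Rightarrow> 'b) \<Rightarrow> 'a ordered_graph \<Rightarrow> 'b ordered_graph" where
  "map_graph h G = \<lparr>verts = h ` verts G, edges = (`) h ` edges G,
     less_rel = map_prod h h ` less_rel G\<rparr>"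

lemma isomorphic_map_graph:
  assumes G: "ordered_graph G" and h: "inj_on h (verts G)"
  shows "isomorphic (map_graph h G) G"
proof -
  define k where "k = inv_into (verts G) h"
  have k: "k (h v) = v" if "v \<in> verts G" for v using h that by (simp add: k_def)
  have "bij_betw k (h ` verts G) (verts G)"
    unfolding k_def using h by (intro bij_betw_inv_into) (simp add: bij_betw_def)
  moreover have "(h u, h v) \<in> map_prod h h ` less_rel G \<longleftrightarrow> (u, v) \<in> less_rel G"
    if "u \<in> verts G" "v \<in> verts G" for u v
  proof
    assume "(h u, h v) \<in> map_prod h h ` less_rel G"
    then obtain x y where "(x, y) \<in> less_rel G" "h x = h u" "h y = h v" by auto
    moreover from this have "x = u" "y = v" using that inj_onD[OF h] vless_verts[OF G] by blast+
    ultimately show "(u, v) \<in> less_rel G" by simp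
  qed (rule map_prod_imageI)
  moreover have "{h u, h v} \<in> (`) h ` edges G \<longleftrightarrow> {u, v} \<in> edges G"
    if "u \<in> verts G" "v \<in> verts G" for u v
  proof -
    have "h ` {u, v} = h ` e \<longleftrightarrow> {u, v} = e" if "e \<in> edges G" for e
      using inj_on_image_eq_iff[OF h, of "{u, v}" e] edge_verts(1)[OF G that]
        \<open>u \<in> verts G\<close> \<open>v \<in> verts G\<close> by simp
    then show ?thesis by (auto simp: image_iff)
  qed
  ultimately show ?thesis
    unfolding isomorphic_def map_graph_def by (intro exI[of _ k]) (simp add: k)
qed

theorem theorem10:
  fixes r p :: nat and G :: "'a ordered_graph"
  assumes "0 < r" and "0 < p" and "G \<in> Bal p"
  shows "\<exists>H :: nat ordered_graph. H \<in> Bal p \<and>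
           (\<forall>\<chi>. edge_coloring r H \<chi> \<longrightarrow>
              (\<exists>G'. subgraph G' H \<and> monochromatic \<chi> G' \<and> isomorphic G' G))"
proof -
  have G: "ordered_graph G" using assms(3) by (simp add: Bal_def)
  define n where "n = card (verts G)"
  let ?\<rho> = "rank G"
  have inj: "inj_on ?\<rho> (verts G)"
    using vless_total[OF G] rank_less(1)[OF G] by (metis inj_onI less_irrefl_nat)
  define E where "E = map_prod ?\<rho> ?\<rho> ` darcs G"
  have E: "ascending n E"
    using rank_less[OF G] by (auto simp: ascending_def E_def n_def darcs_def)
  \<comment> \<open>The inverse of the numbering is a homomorphism back to the arcs of
    \<open>G\<close>.\<close>
  have "bal p E"
    by (rule bal_hom[where f = "inv_into (verts G) ?\<rho>", OF _ BalD[OF G assms(3)]])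
       (use vless_verts[OF G] inj in \<open>auto simp: E_def darcs_def\<close>)
  then obtain M D where D: "ascending M D" "bal p D" "arrows r n E M D"
    using arrows_bal[OF E _ assms(1)] by blast
  let ?H = "graph_of M D"
  have H: "ordered_graph ?H" using D(1) by (rule ordered_graph_graph_of)
  have "\<exists>G'. subgraph G' ?H \<and> monochromatic \<chi> G' \<and> isomorphic G' G"
    if \<chi>: "edge_coloring r ?H \<chi>" for \<chi>
  proof -
    \<comment> \<open>An edge colouring is bounded only on edges, whereas \<open>arrows\<close>
      takes colourings bounded everywhere; the default 0 is a colour because \<open>0 < r\<close>.
      On edges of \<open>?H\<close> the values agree with \<open>\<chi>\<close>.\<close>
    let ?\<chi> = "\<lambda>(x, y). if \<chi> {x, y} < r then \<chi> {x, y} else 0"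
    have "\<forall>e. ?\<chi> e < r" using assms(1) by auto
    then obtain g c where g: "strict_mono_on {..<n} g" "g ` {..<n} \<subseteq> {..<M}"
      "\<And>x y. (x, y) \<in> E \<Longrightarrow> (g x, g y) \<in> D \<and> ?\<chi> (g x, g y) = c"
      using D(3)[unfolded arrows_def, THEN spec[of _ ?\<chi>]] by blast
    let ?h = "g \<circ> ?\<rho>"
    let ?G = "map_graph ?h G"
    have \<rho>n: "?\<rho> v < n" if "v \<in> verts G" for v using rank_lt_card[OF G that] by (simp add: n_def)
    have mono: "?h x < ?h y" if "(x, y) \<in> less_rel G" for x y
      using g(1) rank_less(1)[OF G that] \<rho>n vless_verts[OF G that] by (simp add: strict_mono_on_def)
    have injh: "inj_on ?h (verts G)"
      using vless_total[OF G] mono by (metis inj_onI less_irrefl_nat)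
    have hM: "?h v < M" if "v \<in> verts G" for v using g(2) \<rho>n[OF that] by auto
    have e: "?h ` e \<in> edges ?H \<and> \<chi> (?h ` e) = c" if eG: "e \<in> edges G" for e
    proof -
      obtain x y where "e = {x, y}" using edge_verts(2)[OF G eG] by (auto simp: card_2_iff)
      then obtain x y where xy: "e = {x, y}" "(x, y) \<in> less_rel G"
        using edge_less[OF G] eG by (metis insert_commute)
      then have "(x, y) \<in> darcs G" using eG by (simp add: darcs_def)
      then have "(?\<rho> x, ?\<rho> y) \<in> E" unfolding E_def by (rule map_prod_imageI)
      from g(3)[OF this] have *: "(?h x, ?h y) \<in> D" "?\<chi> (?h x, ?h y) = c" by simp_all
      then have "{?h x, ?h y} \<in> edges ?H" by (force simp: graph_of_def)
      moreover from this have "\<chi> {?h x, ?h y} < r" using \<chi> by (simp add: edge_coloring_def)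
      ultimately show ?thesis using * xy by simp
    qed
    have less: "less_rel ?G = less_rel ?H \<inter> verts ?G \<times> verts ?G"
    proof (intro equalityI subrelI)
      fix a b assume "(a, b) \<in> less_rel ?G"
      then show "(a, b) \<in> less_rel ?H \<inter> verts ?G \<times> verts ?G"
        using mono vless_verts[OF G] hM by (fastforce simp: map_graph_def graph_of_def)
    next
      fix a b assume ab: "(a, b) \<in> less_rel ?H \<inter> verts ?G \<times> verts ?G"
      then obtain x y where xy: "a = ?h x" "b = ?h y" "x \<in> verts G" "y \<in> verts G"
        by (auto simp: map_graph_def)
      then have "?h x < ?h y" using ab by (simp add: graph_of_def)
      then have "(x, y) \<in> less_rel G"
        using vless_total[OF G xy(3,4)] mono[of y x] by (metis less_asym' less_irrefl_nat)
      then show "(a, b) \<in> less_rel ?G" using xy by (force simp: map_graph_def)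
    qed
    have "subgraph ?G ?H"
    proof (rule subgraphI[OF H _ _ _ less])
      show "verts ?G \<subseteq> verts ?H" using hM by (auto simp: map_graph_def graph_of_def)
      show "edges ?G \<subseteq> edges ?H" using e by (auto simp: map_graph_def)
      show "e \<subseteq> verts ?G" if "e \<in> edges ?G" for e
        using that edge_verts(1)[OF G] by (fastforce simp: map_graph_def)
    qed
    moreover have "monochromatic \<chi> ?G"
      using e by (auto simp: monochromatic_def map_graph_def)
    ultimately show ?thesis using isomorphic_map_graph[OF G injh] by blast
  qed
  moreover have "?H \<in> Bal p" using BalI[OF H] D darcs_graph_of by simp
  ultimately show ?thesis by blast
qed

end
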